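(* The following series converges and $$\frac{1}{\pi} = \frac{1}{9\sqrt{7}} \sum_{n=0}^{+\infty} (-1)^n\, \frac{(4n)!}{(n!)^4}\, \frac{8 + 65\, n}{63^{2n}}.$$ *)

theory Defs
  imports Complex_Main
begin

end

theory Submission
  imports Defs "HOL-Analysis.Gamma_Function" "HOL-Analysis.Generalised_Binomial_Theorem"
    "HOL-Analysis.Infinite_Sum" "HOL-Real_Asymp.Real_Asymp"
begin

text \<open>The series is the translation, under a quadratic transformation of hypergeometric functions, of the
easier Ramanujan-type series
\[ \sum_{n \ge 0} \frac{(1/2)_n^3}{n!^3} \frac{42 n + 5}{64^n} = \frac{16}{\pi}. \]

The easier series has an elementary proof by the Wilf--Zeilberger method: it is the case \<open>k = 0\<close> of a
sum \<open>\<Sum>n. F n k\<close> which does not depend on \<open>k\<close>, because \<open>F n (k+1) - F n k\<close> telescopes in \<open>n\<close>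
(\<open>wz_pair\<close>, \<open>suminf_wz_F\<close>). As \<open>k\<close> grows, all terms but the first one vanish in the limit, and the first
one tends to \<open>16 / \<pi>\<close> by Wallis' product (\<open>wz_F_le\<close>, \<open>wz_F_0_tendsto\<close>).

The transformation is Whipple's identity
\[ \sum_m \frac{(1/2)_m^3}{m!^3} X^m
   = (1-X)^{-1/2} \sum_n \frac{(4n)!}{256^n\, n!^4} \Bigl(\frac{-4X}{(1-X)^2}\Bigr)^n. \]
At \<open>X = 1/64\<close> one has \<open>-4X/(1-X)\<^sup>2 = -256/63\<^sup>2\<close>, and the operator \<open>5 + 42 X d/dX\<close> that produces the
factors \<open>42 m + 5\<close> on the left turns the \<open>n\<close>-th term on the right into a multiple of \<open>65 n + 8\<close>.
Both facts come out of one double series: each right-hand term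
is expanded in powers of \<open>X\<close> by the binomial series (\<open>expansion_term_sums\<close>), and collecting equal powers
leaves a terminating sum of Saalschuetz type with a closed form (\<open>saalschutz\<close>,
\<open>expansion_term_diagonal\<close>). The rearrangement is legitimate because the double series converges
absolutely.\<close>

section \<open>A Wilf--Zeilberger proof of the series with 42 n + 5\<close>

lemma pochhammer_half_pos: "pochhammer (1/2) n > (0::real)"
  by (rule pochhammer_pos) simp

lemma pochhammer_half_le_fact: "pochhammer (1/2) n \<le> (fact n :: real)"
proof (induction n)
  case (Suc n)
  have "pochhammer (1/2) n * (1/2 + real n) \<le> fact n * (1 + real n)"
    using Suc pochhammer_half_pos[of n] by (intro mult_mono) auto
  then show ?case by (simp add: pochhammer_Suc mult_ac)
qed simp

text \<open>A pair \<open>(F, G)\<close> with \<open>F n (k+1) - F n k = G (n+1) k - G n k\<close>, both parts being rational multiples of one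
hypergeometric term \<open>t\<close>. The term is suggested by a very well-poised sum with parameters
\<open>a, b, c, d\<close>, whose natural Gamma factor is
\[ \frac{\Gamma(b)\Gamma(c)\Gamma(d)\,\Gamma(1+a-b-c)\Gamma(1+a-b-d)\Gamma(1+a-c-d)}
   {\Gamma(1+a-b)\Gamma(1+a-c)\Gamma(1+a-d)}, \]
evaluated at \<open>a = 1/2 + 3n + k\<close>, \<open>b = 1/2 + n + k\<close>, \<open>c = d = 1/2 + n\<close>. The cubic polynomial in \<open>F\<close> is then
the solution, unique up to a factor, of the linear equations for its coefficients that express the
telescoping property with \<open>G\<close> a constant multiple of \<open>n t\<close>.\<close>

definition wz_t :: "nat \<Rightarrow> nat \<Rightarrow> real" where
  "wz_t n k = pochhammer (1/2) n ^ 3 * pochhammer (1/2) (n + k) ^ 2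
     / (fact n * 4 ^ n * fact (2 * n + k) ^ 2)"

definition wz_F :: "nat \<Rightarrow> nat \<Rightarrow> real" where
  "wz_F n k = (let x = real n; y = real k in wz_t n k *
     (5 + 24*y + 36*y^2 + 16*y^3 + 62*x + 160*x*y + 104*x*y^2 + 188*x^2 + 224*x^2*y + 168*x^3) /
       (2*x + y + 1)^2)"

definition wz_G :: "nat \<Rightarrow> nat \<Rightarrow> real" where
  "wz_G n k = 32 * real n * wz_t n k"

lemma wz_t_Suc_left:
  "wz_t (Suc n) k = wz_t n k * ((real n + 1/2)^3 * (real n + real k + 1/2)^2
     / (4 * (real n + 1) * ((2 * real n + real k + 1) * (2 * real n + real k + 2))^2))"
proof -
  have "2 * Suc n + k = Suc (Suc (2 * n + k))" by simp
  then have f: "(fact (2 * Suc n + k) :: real)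
      = (2 * real n + real k + 2) * (2 * real n + real k + 1) * fact (2 * n + k)"
    by (simp only: fact_Suc) (simp add: algebra_simps)
  show ?thesis
    unfolding wz_t_def f add_Suc pochhammer_Suc fact_Suc power_Suc
    by (simp add: power_mult_distrib add_ac mult_ac)
qed

lemma wz_t_Suc_right:
  "wz_t n (Suc k) = wz_t n k * ((real n + real k + 1/2)^2 / (2 * real n + real k + 1)^2)"
proof -
  have f: "(fact (2 * n + Suc k) :: real) = (2 * real n + real k + 1) * fact (2 * n + k)"
    by (simp add: algebra_simps)
  show ?thesis
    unfolding wz_t_def f add_Suc_right pochhammer_Suc
    by (simp add: power_mult_distrib add_ac mult_ac)
qed

text \<open>Dividing by \<open>t n k\<close> reduces the claim to a polynomial identity.\<close>

lemma wz_pair: "wz_F n (Suc k) - wz_F n k = wz_G (Suc n) k - wz_G n k"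
proof -
  define x where "x = real n"
  define y where "y = real k"
  have nz: "2*x + y + 1 \<noteq> 0" "2*x + y + 2 \<noteq> 0" "x + 1 \<noteq> 0"
    using of_nat_0_le_iff[of n, where ?'a=real] of_nat_0_le_iff[of k, where ?'a=real]
    unfolding x_def y_def by linarith+
  define u where "u = 2*x + y + 1"
  define v where "v = 2*x + y + 2"
  define w where "w = x + 1"
  have uvw: "u \<noteq> 0" "v \<noteq> 0" "w \<noteq> 0" using nz unfolding u_def v_def w_def by auto
  define P where "P = (\<lambda>x y::real. 5 + 24*y + 36*y^2 + 16*y^3 + 62*x + 160*x*y + 104*x*y^2 + 188*x^2 + 224*x^2*y + 168*x^3)"
  have key: "(x + y + 1/2)^2 * P x (y+1) - P x y * v^2
       = 8 * (x + 1/2)^3 * (x + y + 1/2)^2 - 32 * x * u^2 * v^2"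
    unfolding P_def u_def v_def by algebra
  have "(x + y + 1/2)^2 / u^2 * P x (y+1) / v^2 - P x y / u^2
       = ((x + y + 1/2)^2 * P x (y+1) - P x y * v^2) / (u^2 * v^2)"
    using uvw by (simp add: field_simps)
  also have "\<dots> = 32 * w * ((x + 1/2)^3 * (x + y + 1/2)^2 / (4 * w * (u * v)^2)) - 32 * x"
    unfolding key using uvw by (simp add: field_simps)
  finally have *: "(x + y + 1/2)^2 / u^2 * P x (y+1) / v^2 - P x y / u^2
     = 32 * w * ((x + 1/2)^3 * (x + y + 1/2)^2 / (4 * w * (u * v)^2)) - 32 * x" .
  have F1: "wz_F n (Suc k) = wz_t n k * ((x + y + 1/2)^2 / u^2 * P x (y+1) / v^2)"
    unfolding wz_F_def wz_t_Suc_right Let_def P_def x_def y_def u_def v_def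
    by (simp add: add_ac)
  have F0: "wz_F n k = wz_t n k * (P x y / u^2)"
    unfolding wz_F_def Let_def P_def x_def y_def u_def by simp
  have G1: "wz_G (Suc n) k = wz_t n k * (32 * w * ((x + 1/2)^3 * (x + y + 1/2)^2 / (4 * w * (u * v)^2)))"
    unfolding wz_G_def wz_t_Suc_left x_def y_def u_def v_def w_def by (simp add: add_ac)
  have G0: "wz_G n k = wz_t n k * (32 * x)"
    unfolding wz_G_def x_def by simp
  show ?thesis unfolding F1 F0 G1 G0 right_diff_distrib[symmetric] * ..
qed

text \<open>In other words, the binomial coefficient of \<open>2n + k\<close> over \<open>n\<close> is at least \<open>n + k + 1\<close>. The gain of a factor
\<open>(n + k + 1)\<^sup>2\<close> in the denominator of \<open>t n k\<close> outweighs the linear growth of \<open>F / t\<close>.\<close>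

lemma fact_double_plus_ge:
  assumes "n \<ge> 1"
  shows "(real n + real k + 1) * fact n * fact (n + k) \<le> (fact (2 * n + k) :: real)"
  using assms
proof (induction n rule: nat_induct_at_least)
  case base
  have "2 * 1 + k = Suc (Suc k)" by simp
  then show ?case by (simp only:) (simp add: algebra_simps)
next
  case (Suc n)
  have "2 * Suc n + k = Suc (Suc (2 * n + k))" by simp
  then have f: "(fact (2 * Suc n + k) :: real)
      = ((2 * real n + real k + 2) * (2 * real n + real k + 1)) * fact (2 * n + k)"
    by (simp only: fact_Suc) (simp add: algebra_simps)
  have "(real (Suc n) + real k + 1) * fact (Suc n) * fact (Suc n + k)
     = ((real n + real k + 2) * (real n + 1)) * ((real n + real k + 1) * fact n * fact (n + k))"
    by (simp add: algebra_simps)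
  also have "\<dots> \<le> ((2 * real n + real k + 2) * (2 * real n + real k + 1)) * fact (2 * n + k)"
    using Suc.IH by (intro mult_mono) auto
  finally show ?case unfolding f .
qed

lemma wz_t_nonneg: "wz_t n k \<ge> 0"
  unfolding wz_t_def using pochhammer_half_pos[of n] by simp

lemma wz_t_le:
  assumes "n \<ge> 1"
  shows "wz_t n k \<le> (1/4)^n / (real n + real k + 1)^2"
proof -
  define z where "z = real n + real k + 1"
  have z: "z > 0" unfolding z_def by simp
  have "wz_t n k \<le> fact n ^ 3 * fact (n + k) ^ 2 / (fact n * 4 ^ n * (z * fact n * fact (n + k)) ^ 2)"
    unfolding wz_t_def
  proof (intro frac_le mult_mono power_mono mult_left_mono)
    show "z * fact n * fact (n + k) \<le> fact (2 * n + k)"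
      using fact_double_plus_ge[OF assms] unfolding z_def .
  qed (use z pochhammer_half_pos pochhammer_half_le_fact in \<open>auto intro!: less_imp_le mult_nonneg_nonneg\<close>)
  also have "\<dots> = (1/4)^n / z^2"
    using z by (simp add: field_simps power2_eq_square power3_eq_cube)
  finally show ?thesis unfolding z_def .
qed

lemma wz_F_nonneg: "wz_F n k \<ge> 0"
  unfolding wz_F_def Let_def using wz_t_nonneg[of n k] by (intro divide_nonneg_nonneg mult_nonneg_nonneg add_nonneg_nonneg) auto

text \<open>The factor \<open>(1/4)^n\<close> gives convergence in \<open>n\<close>, the denominator \<open>k + 1\<close> the disappearance of all these
terms, and of their sum, as \<open>k\<close> tends to infinity.\<close>

lemma wz_F_le:
  assumes "n \<ge> 1"
  shows "wz_F n k \<le> 168 * (1/4)^n / (real k + 1)"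
proof -
  define x where "x = real n"
  define y where "y = real k"
  define z where "z = x + y + 1"
  define p where "p = 5 + 24*y + 36*y^2 + 16*y^3 + 62*x + 160*x*y + 104*x*y^2 + 188*x^2 + 224*x^2*y + 168*x^3"
  have xy: "x \<ge> 0" "y \<ge> 0" unfolding x_def y_def by auto
  have z: "z > 0" "z \<ge> y + 1" using xy unfolding z_def by auto
  have "168 * z^3 - p = 163 + 442*x + 316*x^2 + 480*y + 848*x*y + 280*x^2*y + 468*y^2 + 400*x*y^2 + 152*y^3"
    unfolding z_def p_def by (simp add: algebra_simps power2_eq_square power3_eq_cube)
  also have "\<dots> \<ge> 0" using xy by (intro add_nonneg_nonneg mult_nonneg_nonneg) auto
  finally have p: "p \<le> 168 * z^3" by simp
  have p0: "p \<ge> 0" unfolding p_def using xy by (intro add_nonneg_nonneg mult_nonneg_nonneg) auto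
  have "wz_F n k = wz_t n k * p / (2*x + y + 1)^2"
    unfolding wz_F_def Let_def p_def x_def y_def ..
  also have "\<dots> \<le> (1/4)^n / z^2 * (168 * z^3) / z^2"
  proof (intro frac_le mult_mono power_mono)
    show "wz_t n k \<le> (1/4)^n / z^2" using wz_t_le[OF assms] unfolding z_def x_def y_def .
    show "z \<le> 2*x + y + 1" using xy unfolding z_def by simp
  qed (use p p0 z in auto)
  also have "\<dots> = 168 * (1/4)^n / z"
    using z by (simp add: power2_eq_square power3_eq_cube)
  also have "\<dots> \<le> 168 * (1/4)^n / (y + 1)"
    using z xy by (intro divide_left_mono) auto
  finally show ?thesis unfolding y_def .
qed

lemma summable_wz_F: "summable (\<lambda>n. wz_F n k)"
proof (rule summable_comparison_test'[where N = 1])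
  show "summable (\<lambda>n. 168 * (1/4)^n / (real k + 1))"
    by (intro summable_divide summable_mult summable_geometric) simp
qed (use wz_F_le wz_F_nonneg in auto)

lemma wz_G_tendsto: "(\<lambda>n. wz_G n k) \<longlonglongrightarrow> 0"
proof (rule tendsto_sandwich[of "\<lambda>_. 0"])
  show "\<forall>\<^sub>F n in sequentially. wz_G n k \<le> 32 * (real n * (1/4)^n)"
  proof (rule eventually_sequentiallyI[of 1])
    fix n :: nat assume n: "n \<ge> 1"
    have "wz_t n k \<le> (1/4)^n / (real n + real k + 1)^2" by (rule wz_t_le[OF n])
    also have "\<dots> \<le> (1/4)^n / 1" by (intro divide_left_mono) auto
    finally show "wz_G n k \<le> 32 * (real n * (1/4)^n)"
      unfolding wz_G_def by (simp add: mult_left_mono)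
  qed
  show "(\<lambda>n. 32 * (real n * (1/4)^n)) \<longlonglongrightarrow> 0"
    using tendsto_mult_right_zero[OF powser_times_n_limit_0[of "1/4::real"]] by simp
qed (auto simp: wz_G_def wz_t_nonneg)

text \<open>Summing the telescoping relation over \<open>n\<close> leaves only boundary values of \<open>G\<close>: the one at \<open>n = 0\<close> is
killed by the factor \<open>n\<close>, and the one at infinity by the decay of \<open>t\<close>.\<close>

lemma suminf_wz_F: "(\<Sum>n. wz_F n k) = (\<Sum>n. wz_F n 0)"
proof (induction k)
  case (Suc k)
  have "(\<lambda>n. wz_F n (Suc k) - wz_F n k) sums (0 - wz_G 0 k)"
    unfolding wz_pair by (rule telescope_sums[OF wz_G_tendsto])
  moreover have "(\<lambda>n. wz_F n (Suc k) - wz_F n k) sums ((\<Sum>n. wz_F n (Suc k)) - (\<Sum>n. wz_F n k))"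
    by (intro sums_diff summable_sums summable_wz_F)
  ultimately have "(\<Sum>n. wz_F n (Suc k)) - (\<Sum>n. wz_F n k) = 0 - wz_G 0 k"
    by (rule sums_unique2[symmetric])
  also have "\<dots> = 0" by (simp add: wz_G_def)
  finally show ?case using Suc.IH by simp
qed simp

text \<open>Wallis' product, in the form of Euler's limit for \<open>\<Gamma>(1/2) = \<surd>\<pi>\<close>.\<close>

lemma wallis_pochhammer:
  "(\<lambda>k. (pochhammer (1/2) k / fact k)^2 * real k) \<longlonglongrightarrow> 1 / pi"
proof -
  have "(\<lambda>k. 1 / (Gamma_series' (1/2) k)^2) \<longlonglongrightarrow> 1 / (Gamma (1/2 :: real))^2"
    by (intro tendsto_intros Gamma_series'_LIMSEQ) (simp add: Gamma_one_half_real)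
  also have "1 / (Gamma (1/2 :: real))^2 = 1 / pi" by (simp add: Gamma_one_half_real)
  also have "(\<lambda>k. 1 / (Gamma_series' (1/2) k)^2) \<longlonglongrightarrow> 1 / pi \<longleftrightarrow> ?thesis"
  proof (rule tendsto_cong, rule eventually_sequentiallyI[of 1])
    fix k :: nat assume k: "k \<ge> 1"
    then obtain l where l: "k = Suc l" by (cases k) auto
    have "exp (1/2 * ln (real k)) = sqrt (real k)"
      using k by (simp add: powr_half_sqrt[symmetric] powr_def)
    then have "Gamma_series' (1/2) k = fact l * sqrt (real k) / pochhammer (1/2) k"
      unfolding Gamma_series'_def l by simp
    then show "1 / (Gamma_series' (1/2 :: real) k)^2 = (pochhammer (1/2) k / fact k)^2 * real k"
      using k l by (simp add: power_divide power_mult_distrib power2_eq_square)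
  qed
  finally show ?thesis .
qed

lemma wz_F_0_tendsto: "(\<lambda>k. wz_F 0 k) \<longlonglongrightarrow> 16 / pi"
proof -
  have "(\<lambda>k. (5 + 24 * real k + 36 * (real k)^2 + 16 * (real k)^3) / (real k * (real k + 1)^2)) \<longlonglongrightarrow> 16"
    by real_asymp
  from tendsto_mult[OF wallis_pochhammer this]
  have "(\<lambda>k. (pochhammer (1/2) k / fact k)^2 * real k *
     ((5 + 24 * real k + 36 * (real k)^2 + 16 * (real k)^3) / (real k * (real k + 1)^2))) \<longlonglongrightarrow> 16 / pi"
    by simp
  moreover have "\<forall>\<^sub>F k in sequentially. (pochhammer (1/2) k / fact k)^2 * real k *
     ((5 + 24 * real k + 36 * (real k)^2 + 16 * (real k)^3) / (real k * (real k + 1)^2)) = wz_F 0 k"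
    by (rule eventually_sequentiallyI[of 1])
       (simp add: wz_F_def wz_t_def power_divide Let_def)
  ultimately show ?thesis by (rule Lim_transform_eventually)
qed

lemma wz_F_sums: "(\<lambda>n. wz_F n 0) sums (16 / pi)"
proof -
  have "(\<lambda>k. \<Sum>n. wz_F (Suc n) k) \<longlonglongrightarrow> 0"
  proof (rule tendsto_sandwich[of "\<lambda>_. 0"])
    have "(\<Sum>n. wz_F (Suc n) k) \<le> (\<Sum>n. 42 * (1/4)^n / (real k + 1))" for k
    proof (rule suminf_le)
      show "wz_F (Suc n) k \<le> 42 * (1/4)^n / (real k + 1)" for n
        using wz_F_le[of "Suc n" k] by simp
      show "summable (\<lambda>n. wz_F (Suc n) k)"
        using summable_wz_F by (subst summable_Suc_iff)
      show "summable (\<lambda>n. 42 * (1/4)^n / (real k + 1))"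
        by (intro summable_divide summable_mult summable_geometric) simp
    qed
    also have "(\<Sum>n. 42 * (1/4)^n / (real k + 1)) = 56 / (real k + 1)" for k
    proof -
      have "(\<lambda>n. 42 * (1/4)^n / (real k + 1)) sums (42 * (1 / (1 - 1/4)) / (real k + 1))"
        by (intro sums_divide sums_mult geometric_sums) simp
      then show ?thesis by (simp add: sums_iff)
    qed
    finally show "\<forall>\<^sub>F k in sequentially. (\<Sum>n. wz_F (Suc n) k) \<le> 56 / (real k + 1)" by simp
    show "(\<lambda>k. 56 / (real k + 1)) \<longlonglongrightarrow> 0" by real_asymp
    show "\<forall>\<^sub>F k in sequentially. 0 \<le> (\<Sum>n. wz_F (Suc n) k)"
      by (intro always_eventually allI suminf_nonneg wz_F_nonneg summable_ignore_initial_segment[OF summable_wz_F, of 1, simplified])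
  qed simp
  from tendsto_add[OF this wz_F_0_tendsto]
  have "(\<lambda>k. \<Sum>n. wz_F n k) \<longlonglongrightarrow> 16 / pi"
    using suminf_split_head[OF summable_wz_F] by (simp add: algebra_simps)
  moreover have "(\<lambda>k. \<Sum>n. wz_F n k) = (\<lambda>k. \<Sum>n. wz_F n 0)"
    by (intro ext suminf_wz_F)
  ultimately have "(\<Sum>n. wz_F n 0) = 16 / pi"
    by (simp add: LIMSEQ_const_iff)
  then show ?thesis using summable_wz_F by (simp add: sums_iff)
qed

lemma ramanujan_42_sums:
  "(\<lambda>n. (pochhammer (1/2) n / fact n)^3 * (42 * real n + 5) / 64^n) sums (16 / pi)"
proof -
  have "wz_F n 0 = (pochhammer (1/2) n / fact n)^3 * (42 * real n + 5) / 64^n" for n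
  proof -
    define x where "x = real n"
    have x: "2 * x + 1 \<noteq> 0" unfolding x_def by linarith
    \<comment> \<open>For \<open>k = 0\<close> the cubic polynomial cancels the denominator of \<open>F\<close>.\<close>
    have p: "5 + 62*x + 188*x^2 + 168*x^3 = (42*x + 5) * (2*x + 1)^2" by algebra
    have "(64::real)^n = 4^n * 4^n * 4^n" by (simp flip: power_mult_distrib)
    moreover have "wz_t n 0 = (pochhammer (1/2) n / fact n)^3 / (4^n * 4^n * 4^n)"
    proof -
      have "(fact (2 * n) :: real) = 4^n * pochhammer (1/2) n * fact n"
        by (simp add: fact_double power_mult)
      then show ?thesis
        using pochhammer_half_pos[of n] unfolding wz_t_def add_0_right
        by (simp only:) (simp add: field_simps power2_eq_square power3_eq_cube)
    qed
    moreover have "wz_F n 0 = wz_t n 0 * (5 + 62*x + 188*x^2 + 168*x^3) / (2*x + 1)^2"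
      unfolding wz_F_def x_def Let_def by simp
    ultimately show ?thesis unfolding p using x by (simp add: x_def)
  qed
  with wz_F_sums show ?thesis by simp
qed

section \<open>The terminating sum behind Whipple's transformation\<close>

text \<open>The term \<open>(-1)^n (1/2)\<^sub>n (1/2)\<^bsub>m+n\<^esub> / (n!\<^sup>3 (m-n)!)\<close>. Writing it with a binomial coefficient makes it vanish
for \<open>n > m\<close>, so that sums over slightly different ranges agree and no boundary corrections appear.\<close>

definition saalschutz_term :: "nat \<Rightarrow> nat \<Rightarrow> real" where
  "saalschutz_term m n = (-1)^n * pochhammer (1/2) n * pochhammer (1/2) (m + n) * real (m choose n) / (fact n ^ 2 * fact m)"

definition saalschutz_cert :: "nat \<Rightarrow> nat \<Rightarrow> real" where
  "saalschutz_cert m n = - (2 * real m + 3/2) * real n ^ 3 *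
     ((-1)^n * pochhammer (1/2) n * pochhammer (1/2) (m + n) * real (Suc m choose n) / (fact n ^ 2 * fact (Suc m)))"

text \<open>Again a telescoping relation: the closed form \<open>((1/2)\<^sub>m / m!)\<^sup>3\<close> satisfies the recurrence with the coefficients
on the left. In terms of \<open>c\<close>, the common part written with \<open>Suc m choose n\<close>, all four quantities are
polynomial multiples.\<close>

lemma saalschutz_telescope:
  "(real m + 1)^3 * saalschutz_term (Suc m) n - (real m + 1/2)^3 * saalschutz_term m n = saalschutz_cert m (Suc n) - saalschutz_cert m n"
proof -
  define x where "x = real m"
  define y where "y = real n"
  define c where "c = (-1)^n * pochhammer (1/2) n * pochhammer (1/2) (m + n) * real (Suc m choose n) / (fact n ^ 2 * fact (Suc m))"
  have nz: "x + 1 \<noteq> 0" "y + 1 \<noteq> 0" unfolding x_def y_def by (auto simp: add_eq_0_iff)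
  have b0: "(x + 1) * real (m choose n) = (x + 1 - y) * real (Suc m choose n)"
  proof (cases "n \<le> Suc m")
    case True
    then have "Suc m * (m choose n) = (Suc m - n) * (Suc m choose n)"
      using binomial_absorb_comp[of "Suc m" n] by simp
    then have "real (Suc m) * real (m choose n) = real (Suc m - n) * real (Suc m choose n)"
      by (metis of_nat_mult)
    then show ?thesis using True by (simp add: x_def y_def of_nat_diff add_ac)
  qed (simp add: binomial_eq_0)
  have b1: "(y + 1) * real (Suc m choose Suc n) = (x + 1 - y) * real (Suc m choose n)"
  proof -
    have "real (Suc n) * real (Suc m choose Suc n) = real (Suc m) * real (m choose n)"
      by (metis Suc_times_binomial of_nat_mult)
    then show ?thesis using b0 by (simp add: x_def y_def add_ac)
  qed
  have s1: "saalschutz_term (Suc m) n = (x + y + 1/2) * c"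
    unfolding saalschutz_term_def c_def x_def y_def by (simp add: pochhammer_Suc add_ac)
  have s0: "saalschutz_term m n = (x + 1 - y) * c"
  proof -
    have "saalschutz_term m n = (-1)^n * pochhammer (1/2) n * pochhammer (1/2) (m + n) * ((x + 1) * real (m choose n)) / (fact n ^ 2 * fact (Suc m))"
      unfolding saalschutz_term_def using nz(1) by (simp add: x_def add_ac)
    then show ?thesis unfolding b0 c_def by simp
  qed
  have c1: "saalschutz_cert m (Suc n) = (2 * x + 3/2) * (y + 1/2) * (x + y + 1/2) * (x + 1 - y) * c"
  proof -
    have cancel: "- A * z^3 * (- e * (p * b) * (q * d) * C / ((z * f)^2 * g))
        = A * b * d * (e * p * q / (f^2 * g)) * (z * C)"
      if "z \<noteq> 0" for A z e p b q d C f g :: real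
      using that by (simp add: power2_eq_square power3_eq_cube mult_ac)
    have "saalschutz_cert m (Suc n) = - (2 * x + 3/2) * (y + 1)^3 *
       (- ((-1)^n) * (pochhammer (1/2) n * (y + 1/2)) * (pochhammer (1/2) (m + n) * (x + y + 1/2))
         * real (Suc m choose Suc n) / (((y + 1) * fact n) ^ 2 * fact (Suc m)))"
      unfolding saalschutz_cert_def add_Suc_right pochhammer_Suc fact_Suc[of n]
      by (simp add: x_def y_def add_ac del: fact_Suc binomial_Suc_Suc)
    then show ?thesis unfolding cancel[OF nz(2)] b1 c_def by simp
  qed
  have c0: "saalschutz_cert m n = - (2 * x + 3/2) * y^3 * c"
    unfolding saalschutz_cert_def c_def x_def y_def by simp
  show ?thesis unfolding s1 s0 c1 c0 x_def[symmetric] y_def[symmetric] by algebra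
qed

text \<open>The terminating balanced \<open>\<^sub>3F\<^sub>2\<close> sum with upper parameters \<open>-m, m + 1/2, 1/2\<close> and lower parameters \<open>1, 1\<close>.\<close>

lemma saalschutz: "(\<Sum>n\<le>m. saalschutz_term m n) = (pochhammer (1/2) m / fact m) ^ 3"
proof (induction m)
  case 0 show ?case by (simp add: saalschutz_term_def)
next
  case (Suc m)
  have "(real m + 1)^3 * (\<Sum>n\<le>Suc m. saalschutz_term (Suc m) n) - (real m + 1/2)^3 * (\<Sum>n\<le>Suc m. saalschutz_term m n)
     = (\<Sum>n\<le>Suc m. saalschutz_cert m (Suc n) - saalschutz_cert m n)"
    unfolding sum_distrib_left sum_subtractf[symmetric] saalschutz_telescope ..
  also have "\<dots> = saalschutz_cert m (Suc (Suc m)) - saalschutz_cert m 0"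
    unfolding lessThan_Suc_atMost[symmetric] by (rule sum_lessThan_telescope)
  also have "\<dots> = 0" by (simp add: saalschutz_cert_def binomial_eq_0 del: binomial_Suc_Suc)
  also have "(\<Sum>n\<le>Suc m. saalschutz_term m n) = (pochhammer (1/2) m / fact m) ^ 3"
    unfolding Suc.IH[symmetric] by (simp add: saalschutz_term_def)
  finally have "(real m + 1)^3 * (\<Sum>n\<le>Suc m. saalschutz_term (Suc m) n)
      = ((real m + 1/2) * (pochhammer (1/2) m / fact m)) ^ 3"
    unfolding power_mult_distrib by linarith
  then have "(\<Sum>n\<le>Suc m. saalschutz_term (Suc m) n)
      = ((real m + 1/2) * (pochhammer (1/2) m / fact m) / (real m + 1)) ^ 3"
    unfolding power_divide by (simp add: eq_divide_eq mult.commute)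
  also have "(real m + 1/2) * (pochhammer (1/2) m / fact m) / (real m + 1)
      = pochhammer (1/2) (Suc m) / fact (Suc m)"
    by (simp add: pochhammer_Suc add_ac mult_ac)
  finally show ?case .
qed

section \<open>Double series and binomial expansions\<close>

text \<open>Fubini for an absolutely convergent double series: summing by rows and summing along the
antidiagonals \<open>n + j = m\<close> give the same value.\<close>

lemma sums_diagonals:
  fixes h :: "nat \<Rightarrow> nat \<Rightarrow> real"
  assumes inner: "\<And>n. (\<lambda>j. h n j) sums r n"
    and abs_inner: "\<And>n. (\<lambda>j. \<bar>h n j\<bar>) sums R n"
    and outer: "summable R"
  shows "summable r" and "(\<lambda>m. \<Sum>n\<le>m. h n (m - n)) sums (\<Sum>n. r n)"
proof -
  have R: "((\<lambda>j. \<bar>h n j\<bar>) has_sum R n) UNIV" for n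
    by (rule sums_nonneg_imp_has_sum[OF abs_inner]) simp
  have R0: "R n \<ge> 0" for n
    using abs_inner[of n] by (metis abs_ge_zero sums_iff suminf_nonneg)
  have r: "((\<lambda>j. h n j) has_sum r n) UNIV" for n
    using norm_summable_imp_has_sum[OF _ inner, of n] abs_inner[of n] by (auto simp: sums_iff)
  have "(\<lambda>(n, j). h n j) abs_summable_on (UNIV \<times> UNIV)"
  proof (subst abs_summable_on_Sigma_iff, intro conjI ballI)
    show "(\<lambda>j. case (n, j) of (n, j) \<Rightarrow> h n j) abs_summable_on UNIV" for n
      using R[of n] by (auto simp: summable_on_def)
    have "(\<Sum>\<^sub>\<infinity>j\<in>UNIV. norm (case (n, j) of (n, j) \<Rightarrow> h n j)) = R n" for n
      using infsumI[OF R[of n]] by simp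
    moreover have "R abs_summable_on UNIV"
      using outer R0 by (intro norm_summable_imp_summable_on) auto
    ultimately show "(\<lambda>n. \<Sum>\<^sub>\<infinity>j\<in>UNIV. norm (case (n, j) of (n, j) \<Rightarrow> h n j)) abs_summable_on UNIV"
      by simp
  qed
  then have "(\<lambda>(n, j). h n j) summable_on (UNIV \<times> UNIV)"
    by (rule abs_summable_summable)
  then obtain S where S: "((\<lambda>(n, j). h n j) has_sum S) (UNIV \<times> UNIV)"
    by (auto simp: summable_on_def)
  have "(r has_sum S) UNIV"
    using has_sum_SigmaD[OF S] r by simp
  then have rS: "r sums S" by (rule has_sum_imp_sums)
  then show "summable r" by (simp add: sums_iff)
  have "((\<lambda>(m, n). h n (m - n)) has_sum S) (SIGMA m:UNIV. {..m})"
  proof (rule has_sum_reindex_bij_witness[THEN iffD2, OF _ _ _ _ _ refl S])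
    fix p :: "nat \<times> nat"
    obtain a b where p: "p = (a, b)" by (cases p)
    show "(\<lambda>(m, n). (n, m - n)) p \<in> UNIV \<times> UNIV" by simp
    show "(\<lambda>(n, j). (n + j, n)) p \<in> (SIGMA m:UNIV. {..m})" by (simp add: p)
    show "(\<lambda>(m, n). (n, m - n)) ((\<lambda>(n, j). (n + j, n)) p) = p" by (simp add: p)
    assume "p \<in> (SIGMA m:UNIV. {..m})"
    then show "(\<lambda>(n, j). (n + j, n)) ((\<lambda>(m, n). (n, m - n)) p) = p" by (simp add: p)
    show "(\<lambda>(n, j). h n j) ((\<lambda>(m, n). (n, m - n)) p) = (\<lambda>(m, n). h n (m - n)) p" by (simp add: p)
  qed
  then have "((\<lambda>m. \<Sum>n\<le>m. h n (m - n)) has_sum S) UNIV"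
    by (rule has_sum_SigmaD) (auto intro: has_sum_finite)
  then have "(\<lambda>m. \<Sum>n\<le>m. h n (m - n)) sums S" by (rule has_sum_imp_sums)
  with rS show "(\<lambda>m. \<Sum>n\<le>m. h n (m - n)) sums (\<Sum>n. r n)" by (simp add: sums_iff)
qed

lemma binomial_series:
  fixes a x :: real
  assumes "\<bar>x\<bar> < 1"
  shows "(\<lambda>j. pochhammer a j / fact j * x^j) sums (1 - x) powr (- a)"
proof -
  have "(\<lambda>j. ((- a) gchoose j) * (- x)^j) sums (1 + (- x)) powr (- a)"
    using assms by (intro gen_binomial_real) simp
  moreover have "((- a) gchoose j) * (- x)^j = pochhammer a j / fact j * x^j" for j
  proof -
    have "(- 1) ^ j * (- x) ^ j = x ^ j" by (simp flip: power_mult_distrib)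
    then show ?thesis by (simp add: gbinomial_pochhammer mult_ac)
  qed
  ultimately show ?thesis by simp
qed

text \<open>The operator \<open>x d/dx\<close> applied to the binomial series; by \<open>j (a)\<^sub>j / j! = a (a+1)\<^bsub>j-1\<^esub> / (j-1)!\<close> this is again
a binomial series, so that no differentiation is needed.\<close>

lemma binomial_series_deriv:
  fixes a x :: real
  assumes "\<bar>x\<bar> < 1"
  shows "(\<lambda>j. pochhammer a j / fact j * x^j * real j) sums (a * x / (1 - x) * (1 - x) powr (- a))"
proof -
  have s: "(\<lambda>j. a * x * (pochhammer (a + 1) j / fact j * x^j)) sums (a * x * (1 - x) powr (- (a + 1)))"
    by (intro sums_mult binomial_series assms)
  have t: "a * x * (pochhammer (a + 1) j / fact j * x^j)
      = pochhammer a (Suc j) / fact (Suc j) * x^(Suc j) * real (Suc j)" for j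
    by (simp add: pochhammer_rec add_ac mult_ac del: of_nat_Suc)
  have p: "(1 - x) powr (- (a + 1)) = (1 - x) powr (- a) / (1 - x)"
    using assms powr_diff[of "1 - x" "- a" 1] by simp
  from sums_Suc[where f = "\<lambda>j. pochhammer a j / fact j * x^j * real j", OF s[unfolded t p]]
  show ?thesis by simp
qed

section \<open>Translation to the series with 65 n + 8\<close>

definition ramanujan_65 :: "nat \<Rightarrow> real" where
  "ramanujan_65 n = (-1)^n * (fact (4 * n) / fact n ^ 4) * ((8 + 65 * real n) / 63 ^ (2 * n))"

text \<open>The \<open>j\<close>-th term in the expansion of \<open>(5 + 42 X d/dX)\<close> applied to
\<open>(-4X)^n (1-X) powr (- 2n - 1/2)\<close>, with its hypergeometric coefficient, at \<open>X = 1/64\<close>. The power of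
\<open>X\<close> in it is \<open>n + j\<close>.\<close>

definition expansion_term :: "nat \<Rightarrow> nat \<Rightarrow> real" where
  "expansion_term n j = (-1)^n * pochhammer (1/2) n * pochhammer (1/2) (2 * n) / fact n ^ 3 / 64^n *
     (pochhammer (real (2 * n) + 1/2) j / fact j * (1/64)^j * (42 * real (n + j) + 5))"

lemma fact_quadruple:
  "fact (4 * n) / fact n ^ 4 = 64^n * (pochhammer (1/2) n * pochhammer (1/2) (2 * n) / (fact n ^ 3 :: real))"
proof -
  have "4 * n = 2 * (2 * n)" by simp
  then have "(fact (4 * n) :: real) = 2 ^ (2 * (2 * n)) * pochhammer (1/2) (2 * n) * fact (2 * n)"
    by (simp only: fact_double)
  also have "(fact (2 * n) :: real) = 2 ^ (2 * n) * pochhammer (1/2) n * fact n"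
    by (rule fact_double)
  also have "(2::real) ^ (2 * (2 * n)) * pochhammer (1/2) (2 * n) * (2 ^ (2 * n) * pochhammer (1/2) n * fact n)
    = (2 ^ (2 * (2 * n)) * 2 ^ (2 * n)) * (pochhammer (1/2) n * pochhammer (1/2) (2 * n) * fact n)" by simp
  also have "(2::real) ^ (2 * (2 * n)) * 2 ^ (2 * n) = 64 ^ n"
    by (simp add: power_mult flip: power_mult_distrib)
  finally show ?thesis by (simp add: power_numeral_reduce)
qed

lemma fact_quadruple_le: "fact (4 * n) / fact n ^ 4 \<le> (256::real)^n"
proof -
  have "pochhammer (1/2) (2 * n) \<le> (fact (2 * n) :: real)" by (rule pochhammer_half_le_fact)
  also have "\<dots> = 4 ^ n * pochhammer (1/2) n * fact n" by (simp add: fact_double power_mult)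
  finally have "pochhammer (1/2) n * pochhammer (1/2) (2 * n) \<le>
      pochhammer (1/2) n * (4 ^ n * pochhammer (1/2) n * (fact n :: real))"
    using pochhammer_half_pos[of n] by (intro mult_left_mono) auto
  also have "\<dots> \<le> fact n * (4 ^ n * fact n * fact n)"
    using pochhammer_half_pos[of n] pochhammer_half_le_fact[of n] by (intro mult_mono) auto
  also have "\<dots> = 4 ^ n * fact n ^ 3" by (simp add: power3_eq_cube)
  finally have "pochhammer (1/2) n * pochhammer (1/2) (2 * n) / fact n ^ 3 \<le> (4 ^ n :: real)"
    by (simp add: divide_le_eq)
  then have "fact (4 * n) / fact n ^ 4 \<le> (64::real)^n * 4 ^ n"
    unfolding fact_quadruple by (rule mult_left_mono) simp
  then show ?thesis by (simp flip: power_mult_distrib)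
qed

text \<open>At \<open>X = 1/64\<close>, the operator multiplies \<open>X^n (1-X) powr (-a)\<close> with \<open>a = 2n + 1/2\<close> by
\<open>42 n + 5 + 42 a X / (1 - X) = 2 (65 n + 8) / 3\<close>; the irrationality \<open>\<surd>7\<close> stems from
\<open>(1 - X) powr (-1/2) = \<surd>(64/63)\<close>.\<close>

lemma expansion_term_sums: "(\<lambda>j. expansion_term n j) sums (16 / (9 * sqrt 7) * ramanujan_65 n)"
proof -
  define a where "a = real (2 * n) + 1/2"
  define U where "U = (-1)^n * pochhammer (1/2) n * pochhammer (1/2) (2 * n) / fact n ^ 3 / (64^n :: real)"
  define B where "B = (1 - 1/64 :: real) powr (- a)"
  have s: "(\<lambda>j. U * ((42 * real n + 5) * (pochhammer a j / fact j * (1/64)^j)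
        + 42 * (pochhammer a j / fact j * (1/64)^j * real j)))
     sums (U * ((42 * real n + 5) * B + 42 * (a * (1/64) / (1 - 1/64) * B)))"
    unfolding B_def
    by (intro sums_mult sums_add binomial_series binomial_series_deriv) auto
  have t: "expansion_term n j = U * ((42 * real n + 5) * (pochhammer a j / fact j * (1/64)^j)
        + 42 * (pochhammer a j / fact j * (1/64)^j * real j))" for j
    unfolding expansion_term_def U_def[symmetric] a_def[symmetric] by (simp add: algebra_simps add_divide_distrib)
  have "B = (64/63) powr (real (2 * n) + 1/2)"
    unfolding B_def a_def powr_minus by (simp add: powr_divide)
  also have "\<dots> = (64/63)^(2 * n) * sqrt (64/63)"
    unfolding powr_add using powr_realpow[of "64/63" "2 * n"] by (simp add: powr_half_sqrt)
  also have "sqrt (64/63) = 8 / (3 * sqrt 7)"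
  proof -
    have "sqrt 63 = sqrt (3^2 * 7)" by simp
    also have "\<dots> = 3 * sqrt 7" by (subst real_sqrt_mult) simp
    moreover have "sqrt 64 = sqrt (8^2)" by simp
    then have "sqrt 64 = 8" by (simp only: real_sqrt_abs)
    ultimately show ?thesis by (simp add: real_sqrt_divide)
  qed
  finally have B: "B = (64/63)^(2 * n) * (8 / (3 * sqrt 7))" .
  have "(42 * real n + 5) * B + 42 * (a * (1/64) / (1 - 1/64) * B) = 2/3 * (8 + 65 * real n) * B"
    unfolding a_def by (simp add: field_simps)
  then have "U * ((42 * real n + 5) * B + 42 * (a * (1/64) / (1 - 1/64) * B))
     = 2/3 * (8 / (3 * sqrt 7)) * (U * (64/63)^(2 * n) * (8 + 65 * real n))"
    unfolding B by simp
  also have "U * (64/63)^(2 * n) * (8 + 65 * real n) = ramanujan_65 n"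
  proof -
    have "(64::real)^(2*n) = 64^n * 64^n" by (simp add: mult_2 power_add)
    then show ?thesis
      unfolding ramanujan_65_def U_def fact_quadruple by (simp add: power_divide)
  qed
  finally show ?thesis using s unfolding t by simp
qed

text \<open>On the antidiagonal \<open>n + j = m\<close> the product \<open>(1/2)\<^bsub>2n\<^esub> (2n + 1/2)\<^bsub>m-n\<^esub>\<close> collapses to \<open>(1/2)\<^bsub>m+n\<^esub>\<close>, which leaves
the terminating sum evaluated above.\<close>

lemma expansion_term_diagonal:
  "(\<Sum>n\<le>m. expansion_term n (m - n)) = (pochhammer (1/2) m / fact m)^3 * (42 * real m + 5) / 64^m"
proof -
  have "expansion_term n (m - n) = (42 * real m + 5) / 64^m * saalschutz_term m n" if "n \<le> m" for n
  proof -
    have p: "pochhammer (1/2) (m + n) = pochhammer (1/2) (2 * n) * pochhammer (real (2 * n) + 1/2) (m - n)"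
      using pochhammer_product'[of "1/2::real" "2 * n" "m - n"] that by (simp add: add_ac)
    have b: "real (m choose n) = fact m / (fact n * fact (m - n))"
      using binomial_fact[OF that] .
    have q: "(64::real)^m = 64^n * 64^(m - n)" using that by (simp flip: power_add)
    show ?thesis
      unfolding expansion_term_def saalschutz_term_def p b q using that
      by (simp add: power_divide power2_eq_square power3_eq_cube mult_ac)
  qed
  then have "(\<Sum>n\<le>m. expansion_term n (m - n)) = (\<Sum>n\<le>m. (42 * real m + 5) / 64^m * saalschutz_term m n)"
    by (intro sum.cong) auto
  also have "\<dots> = (42 * real m + 5) / 64^m * (pochhammer (1/2) m / fact m)^3"
    unfolding sum_distrib_left[symmetric] saalschutz ..
  finally show ?thesis by simp
qed

lemma summable_abs_ramanujan_65: "summable (\<lambda>n. \<bar>ramanujan_65 n\<bar>)"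
proof (rule summable_comparison_test')
  show "summable (\<lambda>n. 65 * (real (Suc n) * (256/3969)^n))"
    using geometric_deriv_sums[of "256/3969::real"] by (intro summable_mult) (simp add: sums_iff)
  fix n :: nat
  have "\<bar>ramanujan_65 n\<bar> = fact (4 * n) / fact n ^ 4 * ((8 + 65 * real n) / 63 ^ (2 * n))"
    unfolding ramanujan_65_def by (simp add: abs_mult)
  also have "\<dots> \<le> 256^n * (65 * real (Suc n) / 63 ^ (2 * n))"
    by (intro mult_mono fact_quadruple_le divide_right_mono) auto
  also have "\<dots> = 65 * (real (Suc n) * (256/3969)^n)"
    by (simp add: power_mult power_divide)
  finally show "norm \<bar>ramanujan_65 n\<bar> \<le> 65 * (real (Suc n) * (256/3969)^n)" by simp
qed

theorem mainTheorem3: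
  shows "summable (\<lambda>n::nat. (-1) ^ n * (fact (4 * n) / fact n ^ 4)
             * ((8 + 65 * real n) / 63 ^ (2 * n))) \<and>
         1 / pi = 1 / (9 * sqrt 7) *
           (\<Sum>n. (-1) ^ n * (fact (4 * n) / fact n ^ 4)
             * ((8 + 65 * real n) / 63 ^ (2 * n)))"
proof -
  have summ: "summable ramanujan_65"
    using summable_abs_ramanujan_65 by (rule summable_rabs_cancel)
  have abs_sums: "(\<lambda>j. \<bar>expansion_term n j\<bar>) sums (16 / (9 * sqrt 7) * \<bar>ramanujan_65 n\<bar>)" for n
  proof -
    \<comment> \<open>Within one row all terms have the same sign, so the rows of absolute values can be summed explicitly.\<close>
    have "\<bar>expansion_term n j\<bar> = (-1)^n * expansion_term n j" for j
    proof -
      have "pochhammer (real (2 * n) + 1/2) j > 0" by (rule pochhammer_pos) simp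
      moreover have "(-1::real)^n * (-1)^n = 1" by (simp flip: power_mult_distrib)
      ultimately show ?thesis
        using pochhammer_half_pos[of n] pochhammer_half_pos[of "2 * n"]
        unfolding expansion_term_def by (simp add: abs_mult)
    qed
    moreover have "\<bar>ramanujan_65 n\<bar> = (-1)^n * ramanujan_65 n"
      unfolding ramanujan_65_def by (simp add: abs_mult flip: power_mult_distrib)
    ultimately show ?thesis using sums_mult[OF expansion_term_sums[of n], of "(-1)^n"] by (simp add: mult_ac)
  qed
  have "(\<lambda>m. \<Sum>n\<le>m. expansion_term n (m - n)) sums (\<Sum>n. 16 / (9 * sqrt 7) * ramanujan_65 n)"
    using expansion_term_sums abs_sums by (rule sums_diagonals) (intro summable_mult summable_abs_ramanujan_65)
  then have "16 / pi = 16 / (9 * sqrt 7) * (\<Sum>n. ramanujan_65 n)"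
    using ramanujan_42_sums unfolding expansion_term_diagonal suminf_mult[OF summ] by (rule sums_unique2[THEN sym])
  then have "1 / pi = 1 / (9 * sqrt 7) * (\<Sum>n. ramanujan_65 n)" by simp
  with summ show ?thesis unfolding ramanujan_65_def[abs_def] by blast
qed

end
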